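(* Let $C$, $C'$, $P$ and $Q$ be $n\times n$ matrices. Assume that (i) $PCQ\le PC'Q$ (entrywise); (ii) $C'$ has an eigenvector $Qu$ for $\lambda'$, for some nonnegative column vector $u=(u_1,\ldots,u_n)^T$ and $\lambda'\in\mathbb{R}$; (iii) $C$ has a left eigenvector $v^TP$ for $\lambda$, for some nonnegative row vector $v^T=(v_1,\ldots,v_n)$ and $\lambda\in\mathbb{R}$; and (iv) $v^TPQu>0$. Then $\lambda\le\lambda'$. Moreover, $\lambda=\lambda'$ if and only if $(PC'Q)_{ij}=(PCQ)_{ij}$ for all $1\le i,j\le n$ with $v_i\ne0$ and $u_j\ne0$.
   Context: All matrices and vectors are real. "Eigenvector" means right eigenvector (so $C'Qu=\lambda'Qu$, $Qu\neq 0$), and a left eigenvector $w^T$ of $C$ for $\lambda$ satisfies $w^TC=\lambda w^T$, $w\ne0$. *)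

theory Defs
  imports "Jordan_Normal_Form.Char_Poly"
begin

(* Row vectors are represented by the same type as column vectors, so this is w^T A. *)
definition vec_mult_mat :: "'a :: semiring_0 vec \<Rightarrow> 'a mat \<Rightarrow> 'a vec" (infixl "\<^sub>v*" 70) where
  "w \<^sub>v* A = vec (dim_col A) (\<lambda>j. w \<bullet> col A j)"

definition left_eigenvector :: "'a :: comm_ring_1 mat \<Rightarrow> 'a vec \<Rightarrow> 'a \<Rightarrow> bool" where
  "left_eigenvector A w k \<longleftrightarrow>
     w \<in> carrier_vec (dim_row A) \<and> w \<noteq> 0\<^sub>v (dim_row A) \<and> w \<^sub>v* A = k \<cdot>\<^sub>v w"

lemma left_eigenvector_iff_eigenvector_transpose:
  assumes "A \<in> carrier_mat n n"
  shows "left_eigenvector A w k \<longleftrightarrow> eigenvector (transpose_mat A) w k"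
proof -
  have "w \<^sub>v* A = transpose_mat A *\<^sub>v w" if "w \<in> carrier_vec n"
    using that assms
    by (intro eq_vecI) (auto simp: vec_mult_mat_def intro!: comm_scalar_prod[of _ n])
  then show ?thesis
    using assms by (auto simp: left_eigenvector_def eigenvector_def)
qed

end

theory Submission
  imports Defs
begin

text \<open>Pairing \<open>v\<close> with \<open>P C Q u\<close> gives \<open>\<lambda> s\<close> and pairing it with \<open>P C' Q u\<close> gives \<open>\<lambda>' s\<close>, where
  \<open>s = v\<^sup>T P Q u > 0\<close>. Hence \<open>(\<lambda>' - \<lambda>) s\<close> is the sum of the nonnegative terms
  \<open>v\<^sub>i (P C' Q - P C Q)\<^sub>i\<^sub>j u\<^sub>j\<close>, which vanishes precisely when every term does.\<close>

text \<open>Both sides expand to the same double sum of \<open>w $ i * A $$ (i, j) * x $ j\<close>,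
  with the order of summation exchanged. This lets a matrix act on either factor of a
  pairing.\<close>

lemma scalar_prod_vec_mult_mat:
  fixes A :: "'a :: comm_semiring_0 mat"
  assumes "A \<in> carrier_mat nr nc" "x \<in> carrier_vec nc" "w \<in> carrier_vec nr"
  shows "(w \<^sub>v* A) \<bullet> x = w \<bullet> (A *\<^sub>v x)"
proof -
  have "(w \<^sub>v* A) \<bullet> x = (\<Sum>j<nc. \<Sum>i<nr. w $ i * A $$ (i, j) * x $ j)"
    using assms by (auto simp: vec_mult_mat_def scalar_prod_def sum_distrib_right
        atLeast0LessThan intro!: sum.cong)
  also have "\<dots> = (\<Sum>i<nr. \<Sum>j<nc. w $ i * A $$ (i, j) * x $ j)"
    by (rule sum.swap)
  also have "\<dots> = w \<bullet> (A *\<^sub>v x)"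
    using assms by (auto simp: scalar_prod_def sum_distrib_left mult.assoc
        atLeast0LessThan intro!: sum.cong)
  finally show ?thesis .
qed

lemma vec_mult_mat_carrier [simp]:
  "A \<in> carrier_mat nr nc \<Longrightarrow> w \<^sub>v* A \<in> carrier_vec nc"
  by (auto simp: vec_mult_mat_def)

lemma scalar_prod_mult_mat_vec_sum:
  fixes A :: "'a :: semiring_0 mat"
  assumes "A \<in> carrier_mat nr nc" "u \<in> carrier_vec nc" "v \<in> carrier_vec nr"
  shows "v \<bullet> (A *\<^sub>v u) = (\<Sum>i<nr. \<Sum>j<nc. v $ i * A $$ (i, j) * u $ j)"
  using assms by (auto simp: scalar_prod_def sum_distrib_left mult.assoc
      atLeast0LessThan intro!: sum.cong)

text \<open>Associativity lets \<open>P\<close> act on \<open>v\<close> and \<open>Q\<close> on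
  \<open>u\<close>, which isolates \<open>A\<close> between the two vectors of the eigenvector
  hypotheses. It serves for both \<open>C\<close> and \<open>C'\<close>.\<close>

lemma scalar_prod_mult_mat3:
  fixes A P Q :: "'a :: comm_semiring_0 mat"
  assumes "A \<in> carrier_mat n n" "P \<in> carrier_mat n n" "Q \<in> carrier_mat n n"
    and "u \<in> carrier_vec n" "v \<in> carrier_vec n"
  shows "v \<bullet> ((P * A * Q) *\<^sub>v u) = (v \<^sub>v* P) \<bullet> (A *\<^sub>v (Q *\<^sub>v u))"
proof -
  have "(P * A * Q) *\<^sub>v u = P *\<^sub>v (A *\<^sub>v (Q *\<^sub>v u))"
    using assms by (simp add: assoc_mult_mat_vec[of _ n n _ n])
  then show ?thesis
    using assms by (simp add: scalar_prod_vec_mult_mat[of _ n n])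
qed

theorem lemma3p1:
  fixes C C' P Q :: "real mat" and u v :: "real vec" and lam lam' :: real and n :: nat
  assumes "C \<in> carrier_mat n n" and "C' \<in> carrier_mat n n"
    and "P \<in> carrier_mat n n" and "Q \<in> carrier_mat n n"
    and "u \<in> carrier_vec n" and "v \<in> carrier_vec n"
    and "P * C * Q \<le> P * C' * Q"
    and "0\<^sub>v n \<le> u" and "eigenvector C' (Q *\<^sub>v u) lam'"
    and "0\<^sub>v n \<le> v" and "left_eigenvector C (v \<^sub>v* P) lam"
    and "(v \<^sub>v* P) \<bullet> (Q *\<^sub>v u) > 0"
  shows "lam \<le> lam' \<and>
    (lam = lam' \<longleftrightarrow>
      (\<forall>i<n. \<forall>j<n. v $ i \<noteq> 0 \<and> u $ j \<noteq> 0 \<longrightarrow>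
        (P * C' * Q) $$ (i, j) = (P * C * Q) $$ (i, j)))"
proof -
  define M where "M = P * C * Q"
  define M' where "M' = P * C' * Q"
  define s where "s = (v \<^sub>v* P) \<bullet> (Q *\<^sub>v u)"
  \<comment> \<open>The contribution of position \<open>(i, j)\<close> to
    \<open>(lam' - lam) * s\<close>. It is zero exactly when \<open>v $ i = 0\<close>,
    \<open>u $ j = 0\<close> or the two entries agree.\<close>
  define d where "d i j = v $ i * (M' $$ (i, j) - M $$ (i, j)) * u $ j" for i j
  have M: "M \<in> carrier_mat n n" "M' \<in> carrier_mat n n"
    using assms(1-4) by (auto simp: M_def M'_def)
  have w: "v \<^sub>v* P \<in> carrier_vec n" and x: "Q *\<^sub>v u \<in> carrier_vec n"
    using assms(3-6) by auto
  \<comment> \<open>\<open>C\<close> is moved to the left factor, where the left eigenvector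
    equation applies; \<open>C'\<close> below stays on the right factor.\<close>
  have "v \<bullet> (M *\<^sub>v u) = ((v \<^sub>v* P) \<^sub>v* C) \<bullet> (Q *\<^sub>v u)"
    unfolding M_def scalar_prod_mult_mat3[OF assms(1,3-6)]
    using scalar_prod_vec_mult_mat[OF assms(1) x w] by simp
  also have "\<dots> = lam * s"
    using assms(11) w x by (simp add: left_eigenvector_def s_def)
  finally have M_eq: "v \<bullet> (M *\<^sub>v u) = lam * s" .
  have "v \<bullet> (M' *\<^sub>v u) = (v \<^sub>v* P) \<bullet> (C' *\<^sub>v (Q *\<^sub>v u))"
    unfolding M'_def by (rule scalar_prod_mult_mat3[OF assms(2-6)])
  also have "\<dots> = lam' * s"
    using assms(9) w x by (simp add: eigenvector_def s_def)
  finally have M'_eq: "v \<bullet> (M' *\<^sub>v u) = lam' * s" .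
  have "(lam' - lam) * s = v \<bullet> (M' *\<^sub>v u) - v \<bullet> (M *\<^sub>v u)"
    by (simp add: M_eq M'_eq algebra_simps)
  also have "\<dots> = (\<Sum>i<n. \<Sum>j<n. d i j)"
    unfolding scalar_prod_mult_mat_vec_sum[OF M(1) assms(5,6)]
      scalar_prod_mult_mat_vec_sum[OF M(2) assms(5,6)] d_def
    by (simp add: sum_subtractf algebra_simps)
  finally have sum_eq: "(lam' - lam) * s = (\<Sum>i<n. \<Sum>j<n. d i j)" .
  \<comment> \<open>The entrywise inequality and the signs of \<open>u\<close> and \<open>v\<close>
    enter here.\<close>
  have d_nonneg: "0 \<le> d i j" if "i < n" "j < n" for i j
  proof -
    have "M $$ (i, j) \<le> M' $$ (i, j)"
      using assms(7) M that by (auto simp: less_eq_mat_def M_def[symmetric] M'_def[symmetric])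
    moreover have "0 \<le> u $ j" "0 \<le> v $ i"
      using assms(5,6,8,10) that by (auto simp: less_eq_vec_def)
    ultimately show ?thesis
      by (simp add: d_def)
  qed
  have s: "0 < s"
    using assms(12) by (simp add: s_def)
  have row: "(\<Sum>j<n. d i j) = 0 \<longleftrightarrow> (\<forall>j<n. d i j = 0)" if "i < n" for i
    using that d_nonneg by (subst sum_nonneg_eq_0_iff) auto
  have "0 \<le> (lam' - lam) * s"
    unfolding sum_eq by (intro sum_nonneg) (auto intro: d_nonneg)
  then have "lam \<le> lam'"
    using s by (simp add: zero_le_mult_iff)
  \<comment> \<open>As \<open>s\<close> is nonzero, \<open>(lam' - lam) * s\<close> vanishes only if
    \<open>lam = lam'\<close>.\<close>
  moreover have "lam = lam' \<longleftrightarrow> (\<Sum>i<n. \<Sum>j<n. d i j) = 0"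
    using s sum_eq[symmetric] by auto
  \<comment> \<open>Zero sums of nonnegative terms are split twice: first into row sums, then by
    \<open>row\<close> into single entries.\<close>
  moreover have "(\<Sum>i<n. \<Sum>j<n. d i j) = 0 \<longleftrightarrow> (\<forall>i<n. \<forall>j<n. d i j = 0)"
    by (subst sum_nonneg_eq_0_iff) (auto intro!: sum_nonneg d_nonneg simp: row)
  ultimately show ?thesis
    by (auto simp: d_def M_def M'_def)
qed

end
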